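(* Let $n$ be a positive integer and let $(A_1,B_1),\ldots,(A_m,B_m)$ be pairs of subsets of $[n]=\{1,\ldots,n\}$ such that $A_i\cap B_i=\emptyset$ for all $1\le i\le m$, and $A_i\cap B_j\neq\emptyset$ for all $1\le i<j\le m$. Then $$\sum_{i=1}^m \frac{1}{\binom{|A_i|+|B_i|}{|A_i|}}\le n+1.$$ Moreover, in case of equality $B_i=[n]\setminus A_i$ holds for all $1\le i\le m$.
   Context: A collection of pairs as in the hypothesis is called a skew Bollobás system. *)

theory Defs
  imports Complex_Main
begin

end

theory Submission
  imports Defs "HOL-Combinatorics.Multiset_Permutations"
begin

text \<open>
  Cut a uniformly random ordering of the ground set into an initial and a final segment.
  The fraction of the orderings that have a cut with \<open>A\<close> in the initial and \<open>B\<close> in the final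
  segment is the reciprocal of the binomial coefficient. In a fixed ordering of \<open>n\<close> elements,
  the skew condition makes the cuts for different pairs different, and there are only \<open>n + 1\<close> cuts.
  An element \<open>x\<close> outside \<open>A\<^sub>i \<union> B\<^sub>i\<close> makes the inequality strict: in an ordering that consists of
  \<open>A\<^sub>i\<close>, then \<open>x\<close>, then the rest, the pair \<open>i\<close> uses both the cut before \<open>x\<close> and the cut after \<open>x\<close>.
\<close>

text \<open>A cut is encoded by the length \<open>k\<close> of the initial segment, so both trivial
  cuts count. Since \<open>take\<close> and \<open>drop\<close> are constant beyond the end of the
  list, the bound on \<open>k\<close> prevents counting the last cut infinitely often.\<close>

definition cuts :: "'a list \<Rightarrow> 'a set \<Rightarrow> 'a set \<Rightarrow> nat set" where
  "cuts xs A B = {k. k \<le> length xs \<and> A \<subseteq> set (take k xs) \<and> B \<subseteq> set (drop k xs)}"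

lemma cuts_subset: "cuts xs A B \<subseteq> {..length xs}"
  by (auto simp: cuts_def)

lemma finite_cuts [simp]: "finite (cuts xs A B)"
  using cuts_subset by (rule finite_subset) simp

lemma cuts_disjoint:
  assumes "distinct xs" "k \<in> cuts xs A B" "k \<in> cuts xs A' B'"
  shows "A \<inter> B' = {}"
proof -
  have "set (take k xs) \<inter> set (drop k xs) = {}"
    using \<open>distinct xs\<close> by (simp add: set_take_disj_set_drop_if_distinct)
  then show ?thesis
    using assms(2,3) unfolding cuts_def by blast
qed

lemma cuts_empty_left: "B \<subseteq> set xs \<Longrightarrow> cuts xs {} B \<noteq> {}"
proof -
  assume "B \<subseteq> set xs"
  then have "0 \<in> cuts xs {} B" by (simp add: cuts_def)
  then show ?thesis by blast
qed

text \<open>A nonempty \<open>A\<close> rules out the cut 0, so \<open>x\<close> lies in the initial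
  segment of every cut. As \<open>x\<close> does not recur in \<open>xs\<close>, it is then missing
  from the final segment, which excludes \<open>x \<in> B\<close>.\<close>

lemma cuts_Cons:
  assumes "A \<noteq> {}" "x \<notin> set xs"
  shows "cuts (x # xs) A B = (if x \<in> B then {} else Suc ` cuts xs (A - {x}) B)"
proof (intro set_eqI)
  fix k
  show "k \<in> cuts (x # xs) A B \<longleftrightarrow> k \<in> (if x \<in> B then {} else Suc ` cuts xs (A - {x}) B)"
    using assms by (cases k) (auto simp: cuts_def dest: in_set_dropD)
qed

text \<open>Induction by removing the first element \<open>x\<close> of the ordering:
  \<open>x \<in> B\<close> admits no cut, \<open>x \<in> A\<close> leaves the same problem for
  \<open>A - {x}\<close>, and any other \<open>x\<close> leaves it for \<open>A\<close> itself. The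
  case \<open>A = {}\<close> is separate: there the cut 0 always works and the binomial coefficient
  is 1.\<close>

lemma card_permutations_cuts:
  assumes "finite S" "A \<subseteq> S" "B \<subseteq> S" "A \<inter> B = {}"
  shows "real (card {xs \<in> permutations_of_set S. cuts xs A B \<noteq> {}})
    = fact (card S) / real ((card A + card B) choose card A)"
  using assms
proof (induction "card S" arbitrary: S A B)
  case 0
  then have "S = {}" "A = {}" "B = {}" by auto
  then show ?case by (simp add: cuts_empty_left)
next
  case (Suc s)
  note fin = \<open>finite S\<close> finite_subset[OF \<open>A \<subseteq> S\<close> \<open>finite S\<close>] finite_subset[OF \<open>B \<subseteq> S\<close> \<open>finite S\<close>]
  let ?N = "\<lambda>S A. {xs \<in> permutations_of_set S. cuts xs A B \<noteq> {}}"
  let ?c = "real ((card A + card B) choose card A)"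
  show ?case
  proof (cases "A = {}")
    case True
    then have "?N S A = permutations_of_set S"
      using Suc.prems by (auto simp: cuts_empty_left permutations_of_set_def)
    with True fin show ?thesis by simp
  next
    case False
    then have "S \<noteq> {}" using Suc.prems by auto
    obtain a where a: "card A = Suc a"
      using False fin by (cases "card A") auto
    have N: "?N S A = (\<Union>x\<in>S - B. (#) x ` ?N (S - {x}) (A - {x}))"
    proof -
      have "?N S A = (\<Union>x\<in>S. (#) x ` {xs \<in> permutations_of_set (S - {x}). cuts (x # xs) A B \<noteq> {}})"
        unfolding permutations_of_set_nonempty[OF \<open>S \<noteq> {}\<close>] by blast
      also have "\<dots> = (\<Union>x\<in>S. if x \<in> B then {} else (#) x ` ?N (S - {x}) (A - {x}))"
        by (intro SUP_cong refl) (auto simp: cuts_Cons[OF False] permutations_of_set_def)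
      also have "\<dots> = (\<Union>x\<in>S - B. (#) x ` ?N (S - {x}) (A - {x}))"
        by (auto split: if_splits simp del: mem_Collect_eq)
      finally show ?thesis .
    qed
    have "card (?N S A) = (\<Sum>x\<in>S - B. card ((#) x ` ?N (S - {x}) (A - {x})))"
      unfolding N using fin by (intro card_UN_disjoint) auto
    also have "\<dots> = (\<Sum>x\<in>S - B. card (?N (S - {x}) (A - {x})))"
      by (simp add: card_image)
    also have "S - B = A \<union> (S - A - B)" using Suc.prems by auto
    also have "(\<Sum>x\<in>A \<union> (S - A - B). card (?N (S - {x}) (A - {x})))
      = (\<Sum>x\<in>A. card (?N (S - {x}) (A - {x}))) + (\<Sum>x\<in>S - A - B. card (?N (S - {x}) (A - {x})))"
      using fin by (intro sum.union_disjoint) auto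
    finally have "real (card (?N S A))
      = (\<Sum>x\<in>A. real (card (?N (S - {x}) (A - {x}))))
        + (\<Sum>x\<in>S - A - B. real (card (?N (S - {x}) (A - {x}))))"
      by simp
    also have "(\<Sum>x\<in>A. real (card (?N (S - {x}) (A - {x}))))
      = (\<Sum>x\<in>A. fact s / real ((a + card B) choose a))"
    proof (rule sum.cong)
      fix x assume "x \<in> A"
      then have "s = card (S - {x})" "a = card (A - {x})"
        using Suc.prems Suc.hyps(2) a fin by auto
      then show "real (card (?N (S - {x}) (A - {x}))) = fact s / real ((a + card B) choose a)"
        using Suc.hyps(1)[of "S - {x}" "A - {x}" B] Suc.prems \<open>x \<in> A\<close> by auto
    qed simp
    also have "(\<Sum>x\<in>S - A - B. real (card (?N (S - {x}) (A - {x}))))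
      = (\<Sum>x\<in>S - A - B. fact s / ?c)"
    proof (rule sum.cong)
      fix x assume "x \<in> S - A - B"
      then have "s = card (S - {x})" "A - {x} = A"
        using Suc.prems Suc.hyps(2) fin by auto
      then show "real (card (?N (S - {x}) (A - {x}))) = fact s / ?c"
        using Suc.hyps(1)[of "S - {x}" A B] Suc.prems \<open>x \<in> S - A - B\<close> by auto
    qed simp
    \<comment> \<open>The absorption identity turns this sum into a multiple of
      \<open>fact s / ?c\<close>. The other sum is one too, and the two coefficients add up to
      \<open>card S\<close>.\<close>
    also have "(\<Sum>x\<in>A. fact s / real ((a + card B) choose a)) = real (card A + card B) * (fact s / ?c)"
    proof -
      have "Suc a * (Suc (a + card B) choose Suc a) = Suc (a + card B) * ((a + card B) choose a)"
        by (rule Suc_times_binomial)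
      then have "real (Suc a) * ?c = real (Suc a + card B) * real ((a + card B) choose a)"
        unfolding a by (metis add_Suc of_nat_mult)
      moreover have "?c > 0" "real ((a + card B) choose a) > 0" by simp_all
      ultimately show ?thesis
        unfolding sum_constant a by (simp add: divide_simps mult_ac del: of_nat_Suc binomial_Suc_Suc)
    qed
    also have "(\<Sum>x\<in>S - A - B. fact s / ?c) = (real (card S) - real (card A + card B)) * (fact s / ?c)"
    proof -
      have "card (A \<union> B) = card A + card B" "card (A \<union> B) \<le> card S"
        using Suc.prems fin by (auto intro: card_Un_disjoint card_mono)
      moreover have "S - A - B = S - (A \<union> B)" by blast
      ultimately have "real (card (S - A - B)) = real (card S) - real (card A + card B)"
        using Suc.prems fin card_Diff_subset[of "A \<union> B" S] by simp
      then show ?thesis by simp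
    qed
    also have "real (card A + card B) * (fact s / ?c)
        + (real (card S) - real (card A + card B)) * (fact s / ?c) = real (card S) * fact s / ?c"
      unfolding distrib_right[symmetric] by simp
    also have "real (card S) * fact s = fact (card S)"
      by (simp add: Suc.hyps(2)[symmetric] del: of_nat_Suc)
    finally show ?thesis .
  qed
qed

text \<open>By \<open>cuts_disjoint\<close>, a cut shared by the pairs \<open>i\<close> and
  \<open>j\<close> would make both \<open>A i \<inter> B j\<close> and
  \<open>A j \<inter> B i\<close> empty. The one-sided condition therefore suffices: whichever index
  is smaller, one of these intersections is nonempty.\<close>

lemma sum_card_cuts_le:
  fixes A B :: "'i::linorder \<Rightarrow> 'a set"
  assumes "finite I" "distinct xs"
    and cross: "\<And>i j. i \<in> I \<Longrightarrow> j \<in> I \<Longrightarrow> i < j \<Longrightarrow> A i \<inter> B j \<noteq> {}"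
  shows "(\<Sum>i\<in>I. card (cuts xs (A i) (B i))) \<le> Suc (length xs)"
proof -
  have "cuts xs (A i) (B i) \<inter> cuts xs (A j) (B j) = {}" if "i \<in> I" "j \<in> I" "i \<noteq> j" for i j
    using that cross cuts_disjoint[OF \<open>distinct xs\<close>]
    by (metis disjoint_iff linorder_neq_iff)
  then have "(\<Sum>i\<in>I. card (cuts xs (A i) (B i))) = card (\<Union>i\<in>I. cuts xs (A i) (B i))"
    using \<open>finite I\<close> by (subst card_UN_disjoint) auto
  also have "\<dots> \<le> card {..length xs}"
    by (intro card_mono) (use cuts_subset in blast)+
  finally show ?thesis by simp
qed

lemma permutation_with_two_cuts:
  assumes "finite S" "A \<subseteq> S" "B \<subseteq> S" "A \<inter> B = {}" "B \<noteq> S - A"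
  obtains xs where "xs \<in> permutations_of_set S" "1 < card (cuts xs A B)"
proof -
  obtain x where x: "x \<in> S" "x \<notin> A" "x \<notin> B"
    using assms by blast
  obtain ys where ys: "set ys = A" "distinct ys"
    using finite_distinct_list finite_subset assms by metis
  obtain zs where zs: "set zs = S - A - {x}" "distinct zs"
    using finite_distinct_list[of "S - A - {x}"] assms by auto
  define xs where "xs = ys @ x # zs"
  \<comment> \<open>The two cuts lie just before and just after \<open>x\<close>. The initial
    segment contains \<open>A = set ys\<close> in both cases, and \<open>B\<close> avoids
    \<open>A\<close> and \<open>x\<close>, so it lies within \<open>set zs\<close>.\<close>
  have "{length ys, Suc (length ys)} \<subseteq> cuts xs A B"
    using ys zs x assms by (auto simp: cuts_def xs_def)
  then have "card {length ys, Suc (length ys)} \<le> card (cuts xs A B)"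
    by (intro card_mono) auto
  moreover have "xs \<in> permutations_of_set S"
    using ys zs x assms by (intro permutations_of_setI) (auto simp: xs_def)
  ultimately show thesis using that by simp
qed

theorem skew_bollobas:
  fixes A B :: "'i::linorder \<Rightarrow> 'a set"
  assumes "finite I" "finite S"
    and sub: "\<And>i. i \<in> I \<Longrightarrow> A i \<subseteq> S" "\<And>i. i \<in> I \<Longrightarrow> B i \<subseteq> S"
    and disj: "\<And>i. i \<in> I \<Longrightarrow> A i \<inter> B i = {}"
    and cross: "\<And>i j. i \<in> I \<Longrightarrow> j \<in> I \<Longrightarrow> i < j \<Longrightarrow> A i \<inter> B j \<noteq> {}"
  defines "w \<equiv> (\<Sum>i\<in>I. 1 / real ((card (A i) + card (B i)) choose card (A i)))"
  shows "w \<le> real (card S) + 1"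
    and "\<lbrakk>w = real (card S) + 1; i \<in> I\<rbrakk> \<Longrightarrow> B i = S - A i"
proof -
  let ?P = "permutations_of_set S"
  let ?sep = "\<lambda>i. {xs \<in> ?P. cuts xs (A i) (B i) \<noteq> {}}"
  let ?total = "\<lambda>i. \<Sum>xs\<in>?P. card (cuts xs (A i) (B i))"
  \<comment> \<open>As a sum of indicators, the number of orderings with some cut can be compared
    with the number of cuts one ordering at a time. The slack in this comparison decides the
    equality case.\<close>
  have card_sep: "card (?sep i) = (\<Sum>xs\<in>?P. of_bool (cuts xs (A i) (B i) \<noteq> {}))" for i
    by (simp add: Int_def)
  have ind_le: "of_bool (cuts xs (A i) (B i) \<noteq> {}) \<le> card (cuts xs (A i) (B i))" for xs i
    by (auto simp: Suc_le_eq card_gt_0_iff)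
  have sep_le: "card (?sep i) \<le> ?total i" for i
    unfolding card_sep by (intro sum_mono ind_le)
  have "w * fact (card S) = (\<Sum>i\<in>I. real (card (?sep i)))"
    unfolding w_def sum_distrib_right using assms
    by (intro sum.cong) (simp_all add: card_permutations_cuts)
  then have w: "w * fact (card S) = real (\<Sum>i\<in>I. card (?sep i))"
    by simp
  \<comment> \<open>After the swap the ordering is fixed, and all pairs compete for its
    \<open>Suc (card S)\<close> cuts.\<close>
  have "(\<Sum>i\<in>I. ?total i) = (\<Sum>xs\<in>?P. \<Sum>i\<in>I. card (cuts xs (A i) (B i)))"
    by (rule sum.swap)
  also have "\<dots> \<le> (\<Sum>xs\<in>?P. Suc (card S))"
  proof (rule sum_mono)
    fix xs assume "xs \<in> ?P"
    then have "distinct xs" "length xs = card S"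
      by (auto simp: permutations_of_set_def distinct_card)
    then show "(\<Sum>i\<in>I. card (cuts xs (A i) (B i))) \<le> Suc (card S)"
      using sum_card_cuts_le[of I xs A B] \<open>finite I\<close> cross by simp
  qed
  also have "\<dots> = fact (card S) * Suc (card S)"
    using \<open>finite S\<close> by simp
  finally have total: "(\<Sum>i\<in>I. ?total i) \<le> fact (card S) * Suc (card S)" .
  have "(\<Sum>i\<in>I. card (?sep i)) \<le> fact (card S) * Suc (card S)"
    by (rule order_trans[OF sum_mono total]) (rule sep_le)
  then have "w * fact (card S) \<le> real (fact (card S) * Suc (card S))"
    unfolding w by (rule of_nat_mono)
  then have "w * fact (card S) \<le> (real (card S) + 1) * fact (card S)"
    by (simp add: algebra_simps)
  then show "w \<le> real (card S) + 1"
    by (rule mult_right_le_imp_le) simp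
  assume eq: "w = real (card S) + 1" and "i \<in> I"
  show "B i = S - A i"
  proof (rule ccontr)
    assume "B i \<noteq> S - A i"
    then obtain xs where xs: "xs \<in> ?P" "1 < card (cuts xs (A i) (B i))"
      using permutation_with_two_cuts \<open>finite S\<close> sub disj \<open>i \<in> I\<close> by metis
    \<comment> \<open>Strictness at this one ordering passes to the sum over all orderings for the
      index \<open>i\<close>, then to the sum over \<open>I\<close>, and so contradicts the assumed
      value of \<open>w\<close>.\<close>
    then have "of_bool (cuts xs (A i) (B i) \<noteq> {}) < card (cuts xs (A i) (B i))"
      by auto
    then have "card (?sep i) < ?total i"
      unfolding card_sep using xs(1) ind_le by (intro sum_strict_mono_ex1 bexI[of _ xs]) auto
    then have "(\<Sum>i\<in>I. card (?sep i)) < (\<Sum>i\<in>I. ?total i)"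
      using \<open>finite I\<close> \<open>i \<in> I\<close> sep_le by (intro sum_strict_mono_ex1) auto
    then have "(\<Sum>i\<in>I. card (?sep i)) < fact (card S) * Suc (card S)"
      using total by linarith
    then have "w * fact (card S) < real (fact (card S) * Suc (card S))"
      unfolding w by (rule of_nat_less_iff[THEN iffD2])
    then show False by (simp add: eq algebra_simps)
  qed
qed

theorem theorem3:
  fixes n m :: nat and A B :: "nat \<Rightarrow> nat set"
  assumes n_pos: "0 < n"
    and A_sub: "\<And>i. i \<in> {1..m} \<Longrightarrow> A i \<subseteq> {1..n}"
    and B_sub: "\<And>i. i \<in> {1..m} \<Longrightarrow> B i \<subseteq> {1..n}"
    and disj: "\<And>i. i \<in> {1..m} \<Longrightarrow> A i \<inter> B i = {}"
    and cross: "\<And>i j. 1 \<le> i \<Longrightarrow> i < j \<Longrightarrow> j \<le> m \<Longrightarrow> A i \<inter> B j \<noteq> {}"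
  shows "(\<Sum>i = 1..m. 1 / real ((card (A i) + card (B i)) choose card (A i))) \<le> real n + 1
    \<and> ((\<Sum>i = 1..m. 1 / real ((card (A i) + card (B i)) choose card (A i))) = real n + 1
        \<longrightarrow> (\<forall>i\<in>{1..m}. B i = {1..n} - A i))"
proof -
  have cross': "A i \<inter> B j \<noteq> {}" if "i \<in> {1..m}" "j \<in> {1..m}" "i < j" for i j
    using cross that by simp
  note skew = skew_bollobas[of "{1..m}" "{1..n}" A B, OF _ _ A_sub B_sub disj cross']
  show ?thesis
  proof (intro conjI impI ballI)
    \<comment> \<open>The cardinality of \<open>{1..n}\<close> unfolds to \<open>Suc n - 1\<close>,
      which still has to be reduced to \<open>n\<close>.\<close>
    show "(\<Sum>i = 1..m. 1 / real ((card (A i) + card (B i)) choose card (A i))) \<le> real n + 1"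
      using skew(1)[OF finite_atLeastAtMost finite_atLeastAtMost] unfolding card_atLeastAtMost
        diff_Suc_1 by blast
  next
    fix i
    assume "(\<Sum>i = 1..m. 1 / real ((card (A i) + card (B i)) choose card (A i))) = real n + 1"
      and "i \<in> {1..m}"
    then show "B i = {1..n} - A i"
      using skew(2)[OF finite_atLeastAtMost finite_atLeastAtMost, of i] unfolding card_atLeastAtMost
        diff_Suc_1 by blast
  qed
qed

end
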